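(* Let $H(s)$ be the Shannon entropy at time $s$ of the rate-1 simple random walk, or of the rate-1 directed random walk, on $\mathbb{Z}$. Then, for $s\ll1$ (i.e. as $s\to0^+$), $$H(s)=s\log(1/s)+O(s).$$
   Context: The rate-1 simple random walk on $\mathbb{Z}$ started at $0$ jumps at rate 1, each jump being $+1$ or $-1$ with probability $1/2$ each; the rate-1 directed random walk is the same but each jump is $+1$. If $X_s$ is the position at time $s$ and $\nu_s$ its law, then $H(s):=-\sum_{x\in\mathbb{Z}}\nu_s(x)\log\nu_s(x)$, with natural logarithm and $0\log0=0$. *)

theory Defs
  imports "HOL-Probability.Probability"
begin

definition exponential_measure :: "real \<Rightarrow> real measure" where
  "exponential_measure l = density lborel (\<lambda>t. ennreal (exponential_density l t))"

definition simple_step :: "int pmf" where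
  "simple_step = pmf_of_set {1, -1}"

definition directed_step :: "int pmf" where
  "directed_step = return_pmf 1"

(* T n is the waiting time between the n-th and the (n+1)-st jump, J n the size of the jump
   that ends it.  The law of each pair being a product measure says that T n is exponential of
   rate 1, that J n has law p, and that the two are independent; together with the independence
   of the pairs, all waiting times and all jump sizes are jointly independent. *)
locale rate1_walk = prob_space M
  for M :: "'a measure" +
  fixes p :: "int pmf"
    and T :: "nat \<Rightarrow> 'a \<Rightarrow> real"
    and J :: "nat \<Rightarrow> 'a \<Rightarrow> int"
  assumes indep_marks:
    "indep_vars (\<lambda>_. borel \<Otimes>\<^sub>M count_space UNIV) (\<lambda>n \<omega>. (T n \<omega>, J n \<omega>)) UNIV"
  and law_mark:
    "\<And>n. distr M (borel \<Otimes>\<^sub>M count_space UNIV) (\<lambda>\<omega>. (T n \<omega>, J n \<omega>)) =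
         exponential_measure 1 \<Otimes>\<^sub>M measure_pmf p"

(* The index set is almost surely finite; on the null set where infinitely many jumps happen
   before time s, the sum is 0 by convention. *)
definition walk_position ::
    "(nat \<Rightarrow> 'a \<Rightarrow> real) \<Rightarrow> (nat \<Rightarrow> 'a \<Rightarrow> int) \<Rightarrow> real \<Rightarrow> 'a \<Rightarrow> int" where
  "walk_position T J s \<omega> = (\<Sum>n | (\<Sum>k\<le>n. T k \<omega>) \<le> s. J n \<omega>)"

definition walk_law ::
    "'a measure \<Rightarrow> (nat \<Rightarrow> 'a \<Rightarrow> real) \<Rightarrow> (nat \<Rightarrow> 'a \<Rightarrow> int) \<Rightarrow> real \<Rightarrow> int \<Rightarrow> real" where
  "walk_law M T J s x = measure M {\<omega> \<in> space M. walk_position T J s \<omega> = x}"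

(* 0 * ln 0 = 0 holds in the library.  If the terms were not summable the sum would be 0 by
   convention. *)
definition shannon_entropy :: "('b \<Rightarrow> real) \<Rightarrow> real" where
  "shannon_entropy \<nu> = - (\<Sum>\<^sub>\<infinity>x. \<nu> x * ln (\<nu> x))"

lemma walk_position_measurable:
  assumes "rate1_walk M p T J"
  shows "walk_position T J s \<in> M \<rightarrow>\<^sub>M count_space UNIV"
proof -
  interpret rate1_walk M p T J by fact
  have pr: "(\<lambda>\<omega>. (T n \<omega>, J n \<omega>)) \<in> M \<rightarrow>\<^sub>M borel \<Otimes>\<^sub>M count_space UNIV" for n
    using indep_marks unfolding indep_vars_def by auto
  have T [measurable]: "T n \<in> borel_measurable M" for n
    using measurable_compose[OF pr[of n] measurable_fst] by simp
  have J [measurable]: "J n \<in> M \<rightarrow>\<^sub>M count_space UNIV" for n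
    using measurable_compose[OF pr[of n] measurable_snd] by simp
  have JF [measurable]: "(\<lambda>\<omega>. \<Sum>n\<in>F. J n \<omega>) \<in> M \<rightarrow>\<^sub>M count_space UNIV"
    if "finite F" for F
    using that
  proof (induction F)
    case (insert n F)
    have "(\<lambda>\<omega>. J n \<omega> + (\<Sum>n\<in>F. J n \<omega>)) \<in> M \<rightarrow>\<^sub>M count_space UNIV"
      by (rule measurable_compose_countable'[where f = "\<lambda>j \<omega>. j + (\<Sum>n\<in>F. J n \<omega>)", OF _ J])
         (auto intro!: measurable_compose[OF insert.IH])
    then show ?case using insert by simp
  qed simp
  let ?P = "\<lambda>F \<omega>. \<forall>n. (\<Sum>k\<le>n. T k \<omega>) \<le> s \<longleftrightarrow> n \<in> F"
  have eq: "walk_position T J s \<omega> = x \<longleftrightarrow>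
      (\<exists>ns. ?P (set ns) \<omega> \<and> (\<Sum>n\<in>set ns. J n \<omega>) = x) \<or>
      (x = 0 \<and> \<not> (\<exists>ns. ?P (set ns) \<omega>))" for \<omega> x
  proof (cases "finite {n. (\<Sum>k\<le>n. T k \<omega>) \<le> s}")
    case True
    have P: "?P F \<omega> \<longleftrightarrow> F = {n. (\<Sum>k\<le>n. T k \<omega>) \<le> s}" for F by auto
    obtain ns where "{n. (\<Sum>k\<le>n. T k \<omega>) \<le> s} = set ns"
      using finite_list[OF True] by metis
    then show ?thesis unfolding P walk_position_def by auto
  next
    case False
    have P: "?P F \<omega> \<longleftrightarrow> F = {n. (\<Sum>k\<le>n. T k \<omega>) \<le> s}" for F by auto
    have "set ns \<noteq> {n. (\<Sum>k\<le>n. T k \<omega>) \<le> s}" for ns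
      using False by (metis List.finite_set)
    then show ?thesis using False unfolding P walk_position_def by auto
  qed
  have "Measurable.pred M (\<lambda>\<omega>. walk_position T J s \<omega> = x)" for x
    unfolding eq by measurable
  then show ?thesis
    by (subst measurable_count_space_eq2_countable)
       (auto simp: pred_def vimage_def Int_def conj_commute)
qed

lemma rate1_walk_canonical:
  "rate1_walk (\<Pi>\<^sub>M n\<in>UNIV. exponential_measure 1 \<Otimes>\<^sub>M measure_pmf p) p
     (\<lambda>n \<omega>. fst (\<omega> n)) (\<lambda>n \<omega>. snd (\<omega> n))"
proof -
  let ?E = "exponential_measure 1 \<Otimes>\<^sub>M measure_pmf p"
  let ?N = "borel \<Otimes>\<^sub>M count_space UNIV :: (real \<times> int) measure"
  let ?M = "\<Pi>\<^sub>M n\<in>(UNIV :: nat set). ?E"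
  have E: "prob_space ?E"
    by (intro prob_space_pair measure_pmf.prob_space_axioms)
       (simp add: exponential_measure_def prob_space_exponential_density)
  have s: "sets ?E = sets ?N"
    by (intro sets_pair_measure_cong) (simp_all add: exponential_measure_def)
  interpret prob_space ?M by (intro prob_space_PiM E)
  have law: "distr ?M ?N (\<lambda>\<omega>. \<omega> n) = ?E" for n
  proof -
    have "distr ?M ?N (\<lambda>\<omega>. \<omega> n) = distr ?M ?E (\<lambda>\<omega>. \<omega> n)"
      by (rule distr_cong) (simp_all add: s)
    then show ?thesis using distr_PiM_component[of UNIV "\<lambda>_. ?E" n] E by simp
  qed
  have rv: "(\<lambda>\<omega>. \<omega> n) \<in> ?M \<rightarrow>\<^sub>M ?N" for n
    unfolding measurable_cong_sets[OF refl s[symmetric]] by simp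
  have "indep_vars (\<lambda>_. ?N) (\<lambda>n \<omega>. \<omega> n) UNIV"
  proof (subst indep_vars_iff_distr_eq_PiM)
    have "distr ?M (\<Pi>\<^sub>M n\<in>UNIV. ?N) (\<lambda>x. x) = ?M"
      by (rule distr_id2) (simp add: s cong: sets_PiM_cong)
    then show "distr ?M (\<Pi>\<^sub>M n\<in>UNIV. ?N) (\<lambda>x. \<lambda>n\<in>UNIV. x n) =
        (\<Pi>\<^sub>M n\<in>UNIV. distr ?M ?N (\<lambda>\<omega>. \<omega> n))"
      by (simp add: law restrict_UNIV)
  qed (simp_all add: rv)
  then show ?thesis
    by unfold_locales (simp_all add: law)
qed

end

theory Submission
  imports Defs
begin

text \<open>
  For small \<open>s\<close> the walk has most likely not moved, has made exactly one jump with
  probability about \<open>s\<close>, and needs at least \<open>k\<close> jumps to reach distance \<open>k\<close>, which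
  costs at most \<open>s ^ k\<close> because each of the first \<open>k\<close> waiting times must be at most
  \<open>s\<close>. Hence the law \<open>\<nu>\<close> at time \<open>s\<close> satisfies
  \<open>\<nu> 0 \<ge> 1 - s\<close>, \<open>\<nu> x = pmf p x * s + O(s\<^sup>2)\<close> for \<open>x = 1\<close> and \<open>x = - 1\<close>, and
  \<open>\<nu> x \<le> s ^ \<bar>x\<bar>\<close> for all \<open>x\<close>
  (\<open>walk_law_zero_ge\<close>, \<open>walk_law_one_jump\<close>, \<open>walk_law_le_power\<close>).

  The entropy depends on the walk only through these three estimates
  (\<open>shannon_entropy_estimate\<close>). The atom at \<open>0\<close> contributes \<open>O(s)\<close>. For the atoms at
  \<open>1\<close> and \<open>- 1\<close>, rescaling by \<open>s\<close> gives
  \<open>- \<nu> x * ln (\<nu> x) = \<nu> x * ln (1 / s) + s * (- y * ln y)\<close> with \<open>y = \<nu> x / s \<in> {0..1}\<close>, so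
  the contribution is \<open>pmf p x * s * ln (1 / s) + O(s)\<close>, and the two weights \<open>pmf p x\<close> add up
  to \<open>1\<close>. The remaining atoms are absorbed by \<open>- y * ln y \<le> 2 * sqrt y\<close>: the square root
  halves the exponent of \<open>s ^ \<bar>x\<bar>\<close>, which for \<open>\<bar>x\<bar> \<ge> 2\<close> still leaves a geometric series of
  size \<open>O(s)\<close>. For \<open>0 < s \<le> 1/4\<close> the errors from the atom at \<open>0\<close>, the
  two atoms at distance \<open>1\<close> and the rest are at most \<open>s\<close>, \<open>3 * s\<close> each and \<open>8 * s\<close>.
\<close>

section \<open>Entropy of a law on the integers concentrated near the origin\<close>

lemma neg_mult_ln_nonneg:
  fixes y :: real
  assumes "0 \<le> y" "y \<le> 1"
  shows "0 \<le> - (y * ln y)"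
proof (cases "y = 0")
  case False
  then have "ln y \<le> 0" using assms by simp
  then show ?thesis using assms by (simp add: mult_nonneg_nonpos)
qed simp

lemma neg_mult_ln_le:
  fixes y :: real
  assumes "0 \<le> y"
  shows "- (y * ln y) \<le> 1 - y"
proof (cases "y = 0")
  case False
  then have y: "0 < y" using assms by simp
  have "- ln y \<le> 1 / y - 1"
    using ln_le_minus_one[of "1 / y"] y by (simp add: ln_div)
  then have "y * (- ln y) \<le> y * (1 / y - 1)"
    using y by (intro mult_left_mono) auto
  then show ?thesis using y by (simp add: algebra_simps)
qed simp

lemma neg_mult_ln_le_sqrt:
  fixes y :: real
  assumes "0 \<le> y"
  shows "- (y * ln y) \<le> 2 * sqrt y"
proof -
  let ?r = "sqrt y"
  have "- (?r * ln ?r) \<le> 1"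
    using neg_mult_ln_le[of ?r] assms by (smt (verit) real_sqrt_ge_zero)
  then have "(2 * ?r) * (- (?r * ln ?r)) \<le> (2 * ?r) * 1"
    using assms by (intro mult_left_mono) auto
  moreover have "y * ln y = (2 * ?r) * (?r * ln ?r)"
  proof (cases "y = 0")
    case False
    then have "ln y = 2 * ln ?r" using assms by (simp add: ln_sqrt)
    moreover have "y = ?r * ?r" using assms by simp
    ultimately show ?thesis by (metis mult.assoc mult.commute)
  qed simp
  ultimately show ?thesis by simp
qed

text \<open>Writing \<open>v = s * y\<close> splits \<open>- v * ln v\<close> into \<open>v * ln (1 / s)\<close>, which is linear in
  \<open>v\<close>, and \<open>s\<close> times the bounded quantity \<open>- y * ln y\<close>. The case \<open>a = 0\<close> is included, so
  a site that cannot be reached by one jump needs no separate treatment.\<close>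

lemma neg_mult_ln_of_near_linear:
  fixes s v a :: real
  assumes s: "0 < s" "s \<le> 1" and v: "0 \<le> v" "v \<le> s" and near: "\<bar>v - a * s\<bar> \<le> 2 * s\<^sup>2"
  shows "\<bar>- (v * ln v) - a * (s * ln (1 / s))\<bar> \<le> 3 * s"
proof -
  define y where "y = v / s"
  have vy: "v = s * y" using s by (simp add: y_def)
  have y: "0 \<le> y" "y \<le> 1" using s v by (simp_all add: y_def)
  have slog: "0 \<le> ln (1 / s)" "s * ln (1 / s) \<le> 1"
    using neg_mult_ln_le[of s] s by (simp_all add: ln_div)
  have "v * ln v = v * ln s + s * (y * ln y)"
  proof (cases "y = 0")
    case False
    then have "ln v = ln s + ln y" using s y vy by (simp add: ln_mult)
    then show ?thesis by (simp add: vy algebra_simps)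
  qed (simp add: vy)
  then have split: "- (v * ln v) - a * (s * ln (1 / s))
      = (v - a * s) * ln (1 / s) + s * (- (y * ln y))"
    using s by (simp add: ln_div algebra_simps)
  have "\<bar>(v - a * s) * ln (1 / s)\<bar> \<le> 2 * s\<^sup>2 * ln (1 / s)"
    unfolding abs_mult using near slog by (simp add: mult_right_mono)
  also have "\<dots> = 2 * s * (s * ln (1 / s))" by (simp add: power2_eq_square)
  also have "\<dots> \<le> 2 * s" using slog(2) s by (simp add: mult_left_le)
  finally have 1: "\<bar>(v - a * s) * ln (1 / s)\<bar> \<le> 2 * s" .
  have "0 \<le> - (y * ln y)" "- (y * ln y) \<le> 1"
    using neg_mult_ln_nonneg[OF y] neg_mult_ln_le[of y] y by simp_all
  then have "0 \<le> s * (- (y * ln y))" "s * (- (y * ln y)) \<le> s"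
    using s by (intro mult_nonneg_nonneg mult_left_le; linarith)+
  then have "\<bar>s * (- (y * ln y))\<bar> \<le> s" by simp
  with 1 show ?thesis unfolding split by linarith
qed

lemma has_sum_int_geometric_tail:
  fixes q :: real
  assumes q: "0 \<le> q" "q < 1"
  shows "((\<lambda>x::int. q ^ nat \<bar>x\<bar>) has_sum 2 * (q\<^sup>2 / (1 - q))) {x. 2 \<le> \<bar>x\<bar>}"
proof -
  have "(\<lambda>n. q\<^sup>2 * q ^ n) sums (q\<^sup>2 * (1 / (1 - q)))"
    using q by (intro sums_mult geometric_sums) simp
  then have "((\<lambda>n. q\<^sup>2 * q ^ n) has_sum (q\<^sup>2 / (1 - q))) UNIV"
    using q by (intro sums_nonneg_imp_has_sum) auto
  then have geo: "((\<lambda>n. q ^ (n + 2)) has_sum (q\<^sup>2 / (1 - q))) UNIV"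
    by (simp only: power_add mult.commute)
  have pos: "((\<lambda>x::int. q ^ nat \<bar>x\<bar>) has_sum (q\<^sup>2 / (1 - q))) {x. 2 \<le> x}"
    by (subst has_sum_reindex_bij_witness[where T = UNIV and h = "\<lambda>n. q ^ (n + 2)"
          and i = "\<lambda>n. int n + 2" and j = "\<lambda>x. nat x - 2"])
       (use geo in \<open>auto simp flip: power_Suc intro!: arg_cong[where f = "power q"]\<close>)
  have neg: "((\<lambda>x::int. q ^ nat \<bar>x\<bar>) has_sum (q\<^sup>2 / (1 - q))) {x. x \<le> - 2}"
    by (subst has_sum_reindex_bij_witness[where T = "{x. 2 \<le> x}"
          and h = "\<lambda>x::int. q ^ nat \<bar>x\<bar>" and i = uminus and j = uminus])
       (use pos in auto)
  have "{x::int. 2 \<le> \<bar>x\<bar>} = {x. 2 \<le> x} \<union> {x. x \<le> - 2}" by auto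
  moreover have "{x::int. 2 \<le> x} \<inter> {x. x \<le> - 2} = {}" by auto
  ultimately show ?thesis
    using has_sum_Un_disjoint[OF pos neg] by simp
qed

lemma shannon_entropy_estimate:
  fixes \<nu> :: "int \<Rightarrow> real"
  assumes s: "0 < s" "s \<le> 1/4"
    and nonneg: "\<And>x. 0 \<le> \<nu> x"
    and decay: "\<And>x. \<nu> x \<le> s ^ nat \<bar>x\<bar>"
    and zero: "1 - s \<le> \<nu> 0"
    and one: "\<bar>\<nu> 1 - a * s\<bar> \<le> 2 * s\<^sup>2"
    and minus_one: "\<bar>\<nu> (- 1) - b * s\<bar> \<le> 2 * s\<^sup>2"
    and weights: "a + b = 1"
  shows "\<bar>shannon_entropy \<nu> - s * ln (1 / s)\<bar> \<le> 15 * s"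
proof -
  define h where "h x = - (\<nu> x * ln (\<nu> x))" for x
  define q where "q = sqrt s"
  let ?B = "{x::int. 2 \<le> \<bar>x\<bar>}"
  have q: "0 \<le> q" "q \<le> 1/2" "q\<^sup>2 = s"
    using s real_sqrt_le_mono[of s "1/4"] by (simp_all add: q_def real_sqrt_divide)
  have le1: "\<nu> x \<le> 1" for x
    using decay[of x] power_le_one[of s "nat \<bar>x\<bar>"] s by linarith
  have h_nonneg: "0 \<le> h x" for x
    unfolding h_def by (rule neg_mult_ln_nonneg[OF nonneg le1])
  have h_le: "h x \<le> 2 * q ^ nat \<bar>x\<bar>" for x
  proof -
    have "h x \<le> 2 * sqrt (\<nu> x)"
      unfolding h_def by (rule neg_mult_ln_le_sqrt[OF nonneg])
    also have "\<dots> \<le> 2 * sqrt (s ^ nat \<bar>x\<bar>)" using decay by simp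
    finally show ?thesis by (simp add: q_def real_sqrt_power)
  qed
  have tail: "((\<lambda>x. 2 * q ^ nat \<bar>x\<bar>) has_sum 2 * (2 * (q\<^sup>2 / (1 - q)))) ?B"
    using q by (intro has_sum_cmult_right has_sum_int_geometric_tail) auto
  have summ: "h summable_on ?B"
    using summable_on_comparison_test[OF has_sum_imp_summable[OF tail], of h] h_le h_nonneg
    by auto
  have "infsum h ?B \<le> 2 * (2 * (q\<^sup>2 / (1 - q)))"
    using has_sum_mono[OF has_sum_infsum[OF summ] tail] h_le by auto
  also have "\<dots> \<le> 8 * s"
  proof -
    have "s / (1 - q) \<le> s / (1/2)" using q s by (intro divide_left_mono) auto
    then show ?thesis using q by simp
  qed
  finally have tail_le: "infsum h ?B \<le> 8 * s" .
  have tail_ge: "0 \<le> infsum h ?B" by (intro infsum_nonneg h_nonneg)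
  have "(h has_sum (sum h {0, 1, - 1} + infsum h ?B)) ({0, 1, - 1} \<union> ?B)"
    by (intro has_sum_Un_disjoint has_sum_finite has_sum_infsum summ) auto
  moreover have "{0, 1, - 1} \<union> ?B = (UNIV :: int set)" by auto
  ultimately have "infsum h UNIV = sum h {0, 1, - 1} + infsum h ?B"
    by (metis infsumI)
  moreover have "shannon_entropy \<nu> = infsum h UNIV"
    unfolding shannon_entropy_def h_def by (simp add: infsum_uminus)
  ultimately have H: "shannon_entropy \<nu> = h 0 + h 1 + h (- 1) + infsum h ?B" by simp
  have h0: "h 0 \<le> s"
    using neg_mult_ln_le[OF nonneg[of 0]] zero by (simp add: h_def)
  have h1: "\<bar>h 1 - a * (s * ln (1 / s))\<bar> \<le> 3 * s"
    unfolding h_def using s nonneg[of 1] decay[of 1] one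
    by (intro neg_mult_ln_of_near_linear) auto
  have h2: "\<bar>h (- 1) - b * (s * ln (1 / s))\<bar> \<le> 3 * s"
    unfolding h_def using s nonneg[of "- 1"] decay[of "- 1"] minus_one
    by (intro neg_mult_ln_of_near_linear) auto
  have "a * (s * ln (1 / s)) + b * (s * ln (1 / s)) = s * ln (1 / s)"
    using weights by (metis distrib_right mult_1)
  then show ?thesis
    using H h0 h1 h2 h_nonneg[of 0] tail_le tail_ge s by linarith
qed

section \<open>The law of the walk at a small time\<close>

lemma jump_indices_before_long_wait:
  fixes t :: "nat \<Rightarrow> real"
  assumes "\<And>k. 0 \<le> t k" and "s < t n"
  shows "{m. (\<Sum>k\<le>m. t k) \<le> s} \<subseteq> {..<n}"
proof
  fix m assume m: "m \<in> {m. (\<Sum>k\<le>m. t k) \<le> s}"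
  have "\<not> n \<le> m"
  proof
    assume "n \<le> m"
    then have "t n \<le> (\<Sum>k\<le>m. t k)"
      by (intro member_le_sum) (auto simp: assms)
    then show False using m assms(2) by simp
  qed
  then show "m \<in> {..<n}" by simp
qed

lemma abs_walk_position_le:
  assumes t: "\<And>k. 0 \<le> T k \<omega>" and j: "\<And>k. \<bar>J k \<omega>\<bar> \<le> 1" and "s < T n \<omega>"
  shows "\<bar>walk_position T J s \<omega>\<bar> \<le> int n"
proof -
  let ?A = "{m. (\<Sum>k\<le>m. T k \<omega>) \<le> s}"
  have A: "?A \<subseteq> {..<n}"
    by (rule jump_indices_before_long_wait) fact+
  have "\<bar>walk_position T J s \<omega>\<bar> \<le> (\<Sum>m\<in>?A. \<bar>J m \<omega>\<bar>)"
    unfolding walk_position_def by (rule sum_abs)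
  also have "\<dots> \<le> (\<Sum>m\<in>?A. 1)" by (intro sum_mono j)
  also have "\<dots> = int (card ?A)" by simp
  also have "\<dots> \<le> int n" using card_mono[OF _ A] by simp
  finally show ?thesis .
qed

lemma walk_position_no_jump:
  assumes t: "\<And>k. 0 \<le> T k \<omega>" and "s < T 0 \<omega>"
  shows "walk_position T J s \<omega> = 0"
  using jump_indices_before_long_wait[of "\<lambda>k. T k \<omega>" s 0] assms
  by (simp add: walk_position_def)

lemma walk_position_one_jump:
  assumes t: "\<And>k. 0 \<le> T k \<omega>" and "T 0 \<omega> \<le> s" and "s < T 1 \<omega>"
  shows "walk_position T J s \<omega> = J 0 \<omega>"
proof -
  have "{m. (\<Sum>k\<le>m. T k \<omega>) \<le> s} \<subseteq> {..<1}"
    by (rule jump_indices_before_long_wait) fact+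
  then have "{m. (\<Sum>k\<le>m. T k \<omega>) \<le> s} = {0}" using assms(2) by auto
  then show ?thesis by (simp add: walk_position_def)
qed

context rate1_walk
begin

lemma random_variable_mark [measurable]:
  "(\<lambda>\<omega>. (T n \<omega>, J n \<omega>)) \<in> M \<rightarrow>\<^sub>M borel \<Otimes>\<^sub>M count_space UNIV"
  using indep_marks unfolding indep_vars_def by auto

lemma random_variable_wait [measurable]: "T n \<in> borel_measurable M"
  using measurable_compose[OF random_variable_mark[of n] measurable_fst] by simp

lemma random_variable_jump [measurable]: "J n \<in> M \<rightarrow>\<^sub>M count_space UNIV"
  using measurable_compose[OF random_variable_mark[of n] measurable_snd] by simp

lemma random_variable_position [measurable]: "walk_position T J s \<in> M \<rightarrow>\<^sub>M count_space UNIV"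
  by (rule walk_position_measurable) (rule rate1_walk_axioms)

lemma prob_wait_jump:
  assumes "0 \<le> s"
  shows "\<P>(\<omega> in M. T n \<omega> \<le> s \<and> J n \<omega> \<in> B) = (1 - exp (- s)) * measure (measure_pmf p) B"
proof -
  interpret E: prob_space "exponential_measure 1"
    by (simp add: exponential_measure_def prob_space_exponential_density)
  have setsE: "sets (exponential_measure 1) = sets borel"
    by (simp add: exponential_measure_def)
  have "emeasure (exponential_measure 1) {..s} = ennreal (1 - exp (- s))"
    unfolding exponential_measure_def using emeasure_erlang_density[of 1 0 s] assms
    by (simp add: erlang_CDF_0)
  then have cdf: "measure (exponential_measure 1) {..s} = 1 - exp (- s)"
    using assms by (simp add: measure_def)
  have "\<P>(\<omega> in M. T n \<omega> \<le> s \<and> J n \<omega> \<in> B)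
      = measure (distr M (borel \<Otimes>\<^sub>M count_space UNIV) (\<lambda>\<omega>. (T n \<omega>, J n \<omega>))) ({..s} \<times> B)"
    by (subst measure_distr) (auto intro!: arg_cong[where f = prob])
  also have "\<dots> = measure (exponential_measure 1 \<Otimes>\<^sub>M measure_pmf p) ({..s} \<times> B)"
    by (simp only: law_mark)
  also have "\<dots> = measure (exponential_measure 1) {..s} * measure (measure_pmf p) B"
    by (simp add: measure_def measure_pmf.emeasure_pair_measure_Times setsE enn2real_mult)
  finally show ?thesis by (simp add: cdf)
qed

lemma prob_wait:
  assumes "0 \<le> s"
  shows "\<P>(\<omega> in M. T n \<omega> \<le> s) = 1 - exp (- s)"
  using prob_wait_jump[OF assms, of n UNIV] by simp

lemma prob_wait_le:
  assumes "0 \<le> s"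
  shows "\<P>(\<omega> in M. T n \<omega> \<le> s) \<le> s"
  using prob_wait[OF assms, of n] exp_ge_add_one_self[of "- s"] by simp

lemma AE_wait_pos: "AE \<omega> in M. \<forall>k. 0 < T k \<omega>"
proof -
  have "AE \<omega> in M. \<not> T k \<omega> \<le> 0" for k
    using prob_wait[of 0 k] by (subst prob_Collect_eq_0[symmetric]) auto
  then show ?thesis by (auto simp: AE_all_countable not_le)
qed

lemma AE_jump: "AE \<omega> in M. \<forall>k. J k \<omega> \<in> set_pmf p"
proof -
  have "AE \<omega> in M. J k \<omega> \<in> set_pmf p" for k
  proof -
    have "AE z in exponential_measure 1 \<Otimes>\<^sub>M measure_pmf p. snd z \<in> set_pmf p"
    proof -
      interpret E: prob_space "exponential_measure 1"
        by (simp add: exponential_measure_def prob_space_exponential_density)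
      interpret pair_prob_space "exponential_measure 1" "measure_pmf p" ..
      show ?thesis by (rule AE_pair_measure) (auto simp: AE_measure_pmf)
    qed
    then have "AE z in distr M (borel \<Otimes>\<^sub>M count_space UNIV) (\<lambda>\<omega>. (T k \<omega>, J k \<omega>)).
        snd z \<in> set_pmf p"
      by (simp only: law_mark)
    then show ?thesis by (subst (asm) AE_distr_iff) auto
  qed
  then show ?thesis by (simp add: AE_all_countable)
qed

lemma indep_waits: "indep_vars (\<lambda>_. borel) T UNIV"
  using indep_vars_compose2[OF indep_marks, of "\<lambda>_. fst" "\<lambda>_. borel"] by simp

lemma prob_waits_le_power:
  assumes "0 \<le> s"
  shows "\<P>(\<omega> in M. \<forall>k<n. T k \<omega> \<le> s) \<le> s ^ n"
proof (cases "n = 0")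
  case False
  have "prob (\<Inter>k\<in>{..<n}. T k -` {..s} \<inter> space M) = (\<Prod>k<n. prob (T k -` {..s} \<inter> space M))"
    using False by (intro indep_varsD[OF indep_waits]) auto
  also have "\<dots> \<le> (\<Prod>k<n. s)"
    using prob_wait_le[OF assms] by (intro prod_mono) (auto simp: vimage_def Int_def conj_commute)
  also have "(\<Inter>k\<in>{..<n}. T k -` {..s} \<inter> space M) = {\<omega> \<in> space M. \<forall>k<n. T k \<omega> \<le> s}"
    using False by auto
  finally show ?thesis by simp
qed (simp add: prob_space)

lemma walk_law_zero_ge:
  assumes "0 \<le> s"
  shows "1 - s \<le> walk_law M T J s 0"
proof -
  have "1 - s \<le> 1 - \<P>(\<omega> in M. T 0 \<omega> \<le> s)"
    using prob_wait_le[OF assms] by simp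
  also have "\<dots> = \<P>(\<omega> in M. \<not> T 0 \<omega> \<le> s)"
    by (subst prob_neg) auto
  also have "\<dots> \<le> \<P>(\<omega> in M. walk_position T J s \<omega> = 0)"
  proof (rule finite_measure_mono_AE)
    show "AE \<omega> in M. \<omega> \<in> {\<omega> \<in> space M. \<not> T 0 \<omega> \<le> s} \<longrightarrow>
        \<omega> \<in> {\<omega> \<in> space M. walk_position T J s \<omega> = 0}"
      using AE_wait_pos
    proof eventually_elim
      case (elim \<omega>)
      have "walk_position T J s \<omega> = 0" if "s < T 0 \<omega>"
        using walk_position_no_jump[of T \<omega> s J] elim that
        by (simp add: less_imp_le)
      then show ?case by auto
    qed
  qed measurable
  finally show ?thesis by (simp add: walk_law_def)
qed

text \<open>Reaching distance \<open>k\<close> takes \<open>k\<close> jumps of size at most \<open>1\<close>. Asking only that each of the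
  \<open>k\<close> waiting times, rather than their sum, be at most \<open>s\<close> loses the factor \<open>1 / fact k\<close> of the
  Poisson tail, but makes the bound a product of independent factors.\<close>

lemma walk_law_le_power:
  assumes "0 \<le> s" and p: "\<And>x. x \<in> set_pmf p \<Longrightarrow> \<bar>x\<bar> \<le> 1"
  shows "walk_law M T J s x \<le> s ^ nat \<bar>x\<bar>"
proof -
  have "walk_law M T J s x \<le> \<P>(\<omega> in M. \<forall>k<nat \<bar>x\<bar>. T k \<omega> \<le> s)"
    unfolding walk_law_def
  proof (rule finite_measure_mono_AE)
    show "AE \<omega> in M. \<omega> \<in> {\<omega> \<in> space M. walk_position T J s \<omega> = x} \<longrightarrow>
        \<omega> \<in> {\<omega> \<in> space M. \<forall>k<nat \<bar>x\<bar>. T k \<omega> \<le> s}"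
      using AE_wait_pos AE_jump
    proof eventually_elim
      case (elim \<omega>)
      have "T k \<omega> \<le> s" if "walk_position T J s \<omega> = x" "k < nat \<bar>x\<bar>" for k
      proof (rule ccontr)
        assume "\<not> T k \<omega> \<le> s"
        then have "\<bar>walk_position T J s \<omega>\<bar> \<le> int k"
          using elim p by (intro abs_walk_position_le) (auto simp: less_imp_le)
        then show False using that by linarith
      qed
      then show ?case by auto
    qed
  qed measurable
  also have "\<dots> \<le> s ^ nat \<bar>x\<bar>" by (rule prob_waits_le_power) fact
  finally show ?thesis .
qed

text \<open>Almost surely, unless the first two waiting times are both at most \<open>s\<close>, being at \<open>x \<noteq> 0\<close> means
  exactly that the first jump has happened and has size \<open>x\<close>. The exceptional event has
  probability at most \<open>s\<^sup>2\<close>, and so has the error of replacing \<open>1 - exp (- s)\<close> by \<open>s\<close>.\<close>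

lemma walk_law_one_jump:
  assumes s: "0 \<le> s" "s \<le> 1" and "x \<noteq> 0"
  shows "\<bar>walk_law M T J s x - pmf p x * s\<bar> \<le> 2 * s\<^sup>2"
proof -
  let ?F = "{\<omega> \<in> space M. T 0 \<omega> \<le> s \<and> J 0 \<omega> \<in> {x}}"
  let ?G = "{\<omega> \<in> space M. \<forall>k<2. T k \<omega> \<le> s}"
  let ?X = "{\<omega> \<in> space M. walk_position T J s \<omega> = x}"
  have agree: "AE \<omega> in M. \<omega> \<notin> ?G \<longrightarrow> (\<omega> \<in> ?X \<longleftrightarrow> \<omega> \<in> ?F)"
    using AE_wait_pos AE_space
  proof eventually_elim
    case (elim \<omega>)
    have "walk_position T J s \<omega> = 0" if "s < T 0 \<omega>"
      using walk_position_no_jump[of T \<omega> s J] elim that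
      by (simp add: less_imp_le)
    moreover have "walk_position T J s \<omega> = J 0 \<omega>" if "T 0 \<omega> \<le> s" "s < T (Suc 0) \<omega>"
      using walk_position_one_jump[of T \<omega> s J] elim that by (simp add: less_imp_le)
    ultimately show ?case
      using \<open>x \<noteq> 0\<close> elim by (cases "s < T 0 \<omega>") (auto simp: less_2_cases_iff not_le)
  qed
  have "?F = {\<omega> \<in> space M. T 0 \<omega> \<le> s} \<inter> (J 0 -` {x} \<inter> space M)" by auto
  moreover have "{\<omega> \<in> space M. T 0 \<omega> \<le> s} \<in> events" by measurable
  moreover have "J 0 -` {x} \<inter> space M \<in> events"
    by (rule measurable_sets[OF random_variable_jump]) simp
  ultimately have F_event: "?F \<in> events" by simp
  have G_event: "?G \<in> events" by measurable
  have X_event: "?X \<in> events" by measurable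
  note meas = F_event G_event X_event
  have "prob ?X \<le> prob (?F \<union> ?G)"
    using agree meas by (intro finite_measure_mono_AE) auto
  also have "\<dots> \<le> prob ?F + prob ?G" by (intro measure_Un_le meas)
  finally have up: "prob ?X \<le> prob ?F + prob ?G" .
  have "prob ?F \<le> prob (?X \<union> ?G)"
    using agree meas by (intro finite_measure_mono_AE) auto
  also have "\<dots> \<le> prob ?X + prob ?G" by (intro measure_Un_le meas)
  finally have lo: "prob ?F \<le> prob ?X + prob ?G" .
  have G: "prob ?G \<le> s\<^sup>2" by (rule prob_waits_le_power) fact
  have F: "prob ?F = (1 - exp (- s)) * pmf p x"
    using prob_wait_jump[OF s(1), of 0 "{x}"] by (simp add: pmf.rep_eq)
  have "exp (- s) \<le> 1 / (1 + s)"
    using exp_ge_add_one_self[of s] s by (simp add: exp_minus field_simps)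
  also have "\<dots> \<le> 1 - s + s\<^sup>2"
    using s by (simp add: field_simps power2_eq_square)
  finally have e: "0 \<le> s - (1 - exp (- s))" "s - (1 - exp (- s)) \<le> s\<^sup>2"
    using exp_ge_add_one_self[of "- s"] by simp_all
  have "(s - (1 - exp (- s))) * pmf p x \<le> s\<^sup>2 * 1"
    using e by (intro mult_mono) (auto simp: pmf_le_1)
  moreover have "0 \<le> (s - (1 - exp (- s))) * pmf p x" using e by simp
  ultimately have "\<bar>prob ?F - pmf p x * s\<bar> \<le> s\<^sup>2"
    unfolding F by (simp add: algebra_simps)
  with up lo G show ?thesis unfolding walk_law_def by linarith
qed

lemma shannon_entropy_walk_law_estimate:
  assumes p: "set_pmf p \<subseteq> {1, - 1}" and s: "0 < s" "s \<le> 1/4"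
  shows "\<bar>shannon_entropy (walk_law M T J s) - s * ln (1 / s)\<bar> \<le> 15 * s"
proof (rule shannon_entropy_estimate[OF s])
  show "walk_law M T J s x \<le> s ^ nat \<bar>x\<bar>" for x
    using p s by (intro walk_law_le_power) auto
  show "1 - s \<le> walk_law M T J s 0" using s by (intro walk_law_zero_ge) simp
  show "\<bar>walk_law M T J s 1 - pmf p 1 * s\<bar> \<le> 2 * s\<^sup>2"
    "\<bar>walk_law M T J s (- 1) - pmf p (- 1) * s\<bar> \<le> 2 * s\<^sup>2"
    using s by (intro walk_law_one_jump; simp)+
  show "pmf p 1 + pmf p (- 1) = 1"
    using sum_pmf_eq_1[OF _ p] by simp
qed (simp add: walk_law_def)

end

theorem propositionA13:
  fixes M :: "'a measure" and p :: "int pmf"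
    and T :: "nat \<Rightarrow> 'a \<Rightarrow> real" and J :: "nat \<Rightarrow> 'a \<Rightarrow> int"
  assumes walk: "rate1_walk M p T J"
    and step: "p = simple_step \<or> p = directed_step"
  shows "(\<lambda>s. shannon_entropy (walk_law M T J s) - s * ln (1 / s)) \<in> O[at_right 0](\<lambda>s. s)"
proof (rule bigoI)
  have p: "set_pmf p \<subseteq> {1, - 1}"
    using step by (auto simp: simple_step_def directed_step_def)
  have "eventually (\<lambda>s. s \<in> {0<..<1/4}) (at_right (0::real))"
    by (rule eventually_at_right_real) simp
  then show "\<forall>\<^sub>F s in at_right 0.
      norm (shannon_entropy (walk_law M T J s) - s * ln (1 / s)) \<le> 15 * norm s"
  proof eventually_elim
    case (elim s)
    then show ?case
      using rate1_walk.shannon_entropy_walk_law_estimate[OF walk p, of s] by simp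
  qed
qed

end
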